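(* Let $\{N(t):t\geq 0\}$ be a homogeneous Poisson process of rate $\lambda>0$, and let $\tau$ be a non-negative random variable independent of this process. (a) If $\tau$ is NBU, then $$d_{TV}\left(\mathcal{L}(N(\tau)),\mathrm{Geom}(\mathbb{E}[e^{-\lambda\tau}])\right)\leq 1-\mathbb{E}[e^{-\lambda\tau}]\,(1+\lambda\mathbb{E}[\tau]).$$ (b) If $\tau$ is NWU, then $$d_{TV}\left(\mathcal{L}(N(\tau)),\mathrm{Geom}(\mathbb{E}[e^{-\lambda\tau}])\right)\leq \mathbb{E}[e^{-\lambda\tau}]\,(1+\lambda\mathbb{E}[\tau])-1.$$
   Context: A non-negative random variable $\tau$ is NBU (new better than used) if $\mathbb{P}(\tau>u)\mathbb{P}(\tau>v)\geq\mathbb{P}(\tau>u+v)$ for all $u,v\geq 0$, and NWU (new worse than used) if $\mathbb{P}(\tau>u)\mathbb{P}(\tau>v)\leq\mathbb{P}(\tau>u+v)$ for all $u,v\geq 0$. $\mathcal{L}(X)$ denotes the law of $X$. $\mathrm{Geom}(p)$ is the distribution on $\mathbb{Z}^+=\{0,1,2,\ldots\}$ with mass $p(1-p)^k$ at $k$. The total variation distance between laws of non-negative integer-valued random variables is $d_{TV}(\mathcal{L}(W),\mathcal{L}(Y))=\sup_{A\subseteq\mathbb{Z}^+}|\mathbb{P}(W\in A)-\mathbb{P}(Y\in A)|$. *)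

theory Defs
  imports "HOL-Probability.Probability"
begin

text \<open>
  The index set of a process is the half-line \<open>{0..}\<close>; the values \<open>N t \<omega>\<close> at negative \<open>t\<close>
  are unconstrained. Right-continuity of the paths, with respect to the discrete topology on
  \<open>nat\<close>, makes the randomly stopped process \<open>\<lambda>\<omega>. N (\<tau> \<omega>) \<omega>\<close> measurable. Since the paths are
  monotone, no truncation occurs in the subtractions on \<open>nat\<close>.
\<close>

definition (in prob_space) poisson_process :: "real \<Rightarrow> (real \<Rightarrow> 'a \<Rightarrow> nat) \<Rightarrow> bool" where
  "poisson_process rate N \<longleftrightarrow>
     (\<forall>t\<ge>0. random_variable (count_space UNIV) (N t)) \<and>
     (\<forall>\<omega>\<in>space M. mono_on {0..} (\<lambda>t. N t \<omega>) \<and>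
        (\<forall>t\<ge>0. continuous (at_right t) (\<lambda>s. N s \<omega>))) \<and>
     (AE \<omega> in M. N 0 \<omega> = 0) \<and>
     (\<forall>n (T :: nat \<Rightarrow> real). 0 \<le> T 0 \<longrightarrow> (\<forall>i<n. T i \<le> T (Suc i)) \<longrightarrow>
        indep_vars (\<lambda>_. count_space UNIV) (\<lambda>i \<omega>. N (T (Suc i)) \<omega> - N (T i) \<omega>) {..<n}) \<and>
     (\<forall>s t. 0 \<le> s \<longrightarrow> s < t \<longrightarrow>
        distr M (count_space UNIV) (\<lambda>\<omega>. N t \<omega> - N s \<omega>)
          = measure_pmf (poisson_pmf (rate * (t - s))))"

text \<open>
  Independence of a random variable from the whole process, i.e. of the generated
  sigma-algebras. (\<^const>\<open>prob_space.indep_var\<close> would force both value spaces to have the same type.)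
\<close>

definition (in prob_space) indep_of_process ::
    "('a \<Rightarrow> real) \<Rightarrow> (real \<Rightarrow> 'a \<Rightarrow> nat) \<Rightarrow> bool" where
  "indep_of_process \<tau> N \<longleftrightarrow>
     indep_set
       (sigma_sets (space M) {\<tau> -` B \<inter> space M | B. B \<in> sets borel})
       (sigma_sets (space M) (\<Union>t\<in>{0..}. {N t -` A \<inter> space M | A. A \<in> sets (count_space UNIV)}))"

definition (in prob_space) NBU :: "('a \<Rightarrow> real) \<Rightarrow> bool" where
  "NBU \<tau> \<longleftrightarrow> (\<forall>u\<ge>0. \<forall>v\<ge>0.
     \<P>(\<omega> in M. \<tau> \<omega> > u) * \<P>(\<omega> in M. \<tau> \<omega> > v) \<ge> \<P>(\<omega> in M. \<tau> \<omega> > u + v))"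

definition (in prob_space) NWU :: "('a \<Rightarrow> real) \<Rightarrow> bool" where
  "NWU \<tau> \<longleftrightarrow> (\<forall>u\<ge>0. \<forall>v\<ge>0.
     \<P>(\<omega> in M. \<tau> \<omega> > u) * \<P>(\<omega> in M. \<tau> \<omega> > v) \<le> \<P>(\<omega> in M. \<tau> \<omega> > u + v))"

definition tv_dist :: "nat measure \<Rightarrow> nat measure \<Rightarrow> real" where
  "tv_dist \<mu> \<nu> = (SUP A. \<bar>measure \<mu> A - measure \<nu> A\<bar>)"

text \<open>
  The mean of a non-negative random variable, with value \<open>\<infinity>\<close> when it is not integrable
  (an NWU random variable may have infinite mean, and the Bochner integral would then be \<open>0\<close>).
\<close>

definition ext_mean :: "'a measure \<Rightarrow> ('a \<Rightarrow> real) \<Rightarrow> ereal" where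
  "ext_mean M X = enn2ereal (\<integral>\<^sup>+\<omega>. ennreal (X \<omega>) \<partial>M)"

end

theory Submission
  imports Defs
begin

text \<open>
  Let \<open>W = N(\<tau>)\<close>, \<open>S k = P(W \<ge> k)\<close> and \<open>p = P(W = 0) = E[exp (- rate * \<tau>)]\<close>. Since the \<open>(k+1)\<close>st arrival
  time has an Erlang density \<open>e\<^sub>k\<close>, \<open>S (k + 1)\<close> is the integral of \<open>e\<^sub>k(x) P(\<tau> > x)\<close>. As \<open>e\<^sub>k\<^sub>+\<^sub>1\<close> is the
  convolution of \<open>e\<^sub>k\<close> and \<open>e\<^sub>0\<close>, the NBU property yields \<open>S (k + 1) \<le> S k * S 1 = (1 - p) S k\<close>, with the
  reverse inequality for NWU. The numbers \<open>d k = (1 - p) S k - S (k + 1)\<close> therefore have constant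
  sign, and comparing \<open>S k\<close> with the geometric tails \<open>(1 - p)^k\<close> bounds the one-sided difference of the point
  masses at \<open>k\<close> by \<open>\<bar>d k\<bar>\<close>, so that the total variation distance is at most \<open>\<bar>\<Sum>k. d k\<bar>\<close>. Finally \<open>\<Sum>k. S (k + 1) = rate * E[\<tau>]\<close>, because the densities \<open>e\<^sub>k\<close> sum to the
  constant \<open>rate\<close>, so \<open>\<Sum>k. d k = 1 - p (1 + rate * E[\<tau>])\<close>. In the NBU case the geometric decay of
  the tails shows that the mean is finite.
\<close>

section \<open>Poisson process at an independent random time\<close>

context prob_space
begin

text \<open>The definition prescribes the laws of increments over \<open>s < t\<close>, and
  \<open>N 0\<close> vanishes only almost surely, so the law at \<open>t > 0\<close> is read off the
  increment from time 0.\<close>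

lemma poisson_process_marginal:
  assumes "poisson_process rate N" "t > 0"
  shows "distr M (count_space UNIV) (N t) = measure_pmf (poisson_pmf (rate * t))"
proof -
  have [measurable]: "N t \<in> measurable M (count_space UNIV)" "N 0 \<in> measurable M (count_space UNIV)"
    using assms by (auto simp: poisson_process_def)
  have "AE \<omega> in M. N 0 \<omega> = 0"
    using assms(1) by (auto simp: poisson_process_def)
  then have "distr M (count_space UNIV) (N t) = distr M (count_space UNIV) (\<lambda>\<omega>. N t \<omega> - N 0 \<omega>)"
    by (intro distr_cong_AE) auto
  also have "\<dots> = measure_pmf (poisson_pmf (rate * (t - 0)))"
    using assms unfolding poisson_process_def by blast
  finally show ?thesis by simp
qed

lemma poisson_process_prob_inter:
  assumes pp: "poisson_process rate N" and ind: "indep_of_process \<tau> N" and "rate > 0" "t > 0"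
    and "B \<in> sets borel"
  shows "prob ({\<omega>\<in>space M. \<tau> \<omega> \<in> B} \<inter> {\<omega>\<in>space M. N t \<omega> = k}) =
    prob {\<omega>\<in>space M. \<tau> \<omega> \<in> B} * ((rate * t) ^ k / fact k * exp (- (rate * t)))"
proof -
  have [measurable]: "N t \<in> measurable M (count_space UNIV)"
    using assms by (auto simp: poisson_process_def)
  have "prob (\<tau> -` B \<inter> space M \<inter> (N t -` {k} \<inter> space M)) =
      prob (\<tau> -` B \<inter> space M) * prob (N t -` {k} \<inter> space M)"
  proof (rule indep_setD[OF ind[unfolded indep_of_process_def]])
    show "\<tau> -` B \<inter> space M \<in> sigma_sets (space M) {\<tau> -` B \<inter> space M |B. B \<in> sets borel}"
      using assms(5) by blast
    show "N t -` {k} \<inter> space M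
      \<in> sigma_sets (space M) (\<Union>t\<in>{0..}. {N t -` A \<inter> space M |A. A \<in> sets (count_space UNIV)})"
      using \<open>t > 0\<close> by (intro sigma_sets.Basic) (auto intro!: bexI[of _ t])
  qed
  moreover have "prob (N t -` {k} \<inter> space M) = measure (distr M (count_space UNIV) (N t)) {k}"
    by (simp add: measure_distr)
  moreover have "\<dots> = (rate * t) ^ k / fact k * exp (- (rate * t))"
    using assms by (simp add: poisson_process_marginal[OF pp] measure_pmf_single)
  moreover have "\<tau> -` B \<inter> space M = {\<omega>\<in>space M. \<tau> \<omega> \<in> B}" "N t -` {k} \<inter> space M = {\<omega>\<in>space M. N t \<omega> = k}"
    by auto
  ultimately show ?thesis
    by simp
qed

text \<open>For a time with countably many values the event splits along the value \<open>m\<close>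
  of \<open>J\<close>. On each piece the time is the constant \<open>g m\<close>, so independence
  factors the probability, and summing over \<open>m\<close> rebuilds an integral over
  \<open>\<omega>\<close>. Positivity of \<open>g\<close> keeps the times where the marginal law is
  available.\<close>

lemma poisson_process_discrete_time:
  fixes J :: "'a \<Rightarrow> nat" and g :: "nat \<Rightarrow> real"
  assumes pp: "poisson_process rate N" and ind: "indep_of_process \<tau> N" and "rate > 0"
    and [measurable]: "\<tau> \<in> borel_measurable M" "f \<in> measurable borel (count_space UNIV)"
    and g: "\<And>m. g m > 0" and J: "\<And>\<omega>. J \<omega> = f (\<tau> \<omega>)"
  shows "emeasure M {\<omega>\<in>space M. N (g (J \<omega>)) \<omega> = k} =
    (\<integral>\<^sup>+\<omega>. ennreal ((rate * g (J \<omega>)) ^ k / fact k * exp (- (rate * g (J \<omega>)))) \<partial>M)"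
proof -
  have [measurable]: "N (g m) \<in> measurable M (count_space UNIV)" for m
    using pp g[of m] by (auto simp: poisson_process_def)
  have [measurable]: "J \<in> measurable M (count_space UNIV)"
    unfolding J by measurable
  define h where "h m = (rate * g m) ^ k / fact k * exp (- (rate * g m))" for m
  have h: "h m \<ge> 0" for m
    using g[of m] \<open>rate > 0\<close> by (simp add: h_def)
  let ?A = "\<lambda>m. {\<omega>\<in>space M. J \<omega> = m}" and ?B = "\<lambda>m. {\<omega>\<in>space M. N (g m) \<omega> = k}"
  have [measurable]: "?A m \<in> sets M" "?B m \<in> sets M" for m
    by measurable
  have AB: "prob (?A m \<inter> ?B m) = prob (?A m) * h m" for m
  proof -
    have "f -` {m} \<in> sets borel"
      using measurable_sets[OF assms(5), of "{m}"] by simp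
    from poisson_process_prob_inter[OF pp ind \<open>rate > 0\<close> g this, of m k] show ?thesis
      by (simp add: J h_def)
  qed
  have "{\<omega>\<in>space M. N (g (J \<omega>)) \<omega> = k} = (\<Union>m. ?A m \<inter> ?B m)"
    by auto
  then have "emeasure M {\<omega>\<in>space M. N (g (J \<omega>)) \<omega> = k} = (\<Sum>m. emeasure M (?A m \<inter> ?B m))"
    by (subst suminf_emeasure) (auto simp: disjoint_family_on_def)
  also have "\<dots> = (\<Sum>m. ennreal (h m) * emeasure M (?A m))"
    by (intro suminf_cong) (simp add: emeasure_eq_measure AB ennreal_mult h mult.commute)
  also have "\<dots> = (\<Sum>m. \<integral>\<^sup>+\<omega>. ennreal (h m) * indicator (?A m) \<omega> \<partial>M)"
    by (intro suminf_cong) (simp add: nn_integral_cmult_indicator)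
  also have "\<dots> = (\<integral>\<^sup>+\<omega>. (\<Sum>m. ennreal (h m) * indicator (?A m) \<omega>) \<partial>M)"
    by (intro nn_integral_suminf[symmetric]) measurable
  also have "\<dots> = (\<integral>\<^sup>+\<omega>. ennreal (h (J \<omega>)) \<partial>M)"
    by (intro nn_integral_cong suminf_cmult_indicator) (auto simp: disjoint_family_on_def)
  finally show ?thesis by (simp add: h_def)
qed

text \<open>
  The random time is approximated strictly from above by discrete ones, because the paths are
  only assumed to be right-continuous.
\<close>

lemma poisson_process_random_time:
  assumes pp: "poisson_process rate N" and ind: "indep_of_process \<tau> N" and "rate > 0"
    and \<tau>[measurable]: "\<tau> \<in> borel_measurable M" and nonneg: "\<forall>\<omega>\<in>space M. \<tau> \<omega> \<ge> 0"
  shows "(\<lambda>\<omega>. N (\<tau> \<omega>) \<omega>) \<in> measurable M (count_space UNIV)" (is ?meas)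
    and "emeasure M {\<omega>\<in>space M. N (\<tau> \<omega>) \<omega> = k} =
      (\<integral>\<^sup>+\<omega>. ennreal ((rate * \<tau> \<omega>) ^ k / fact k * exp (- (rate * \<tau> \<omega>))) \<partial>M)" (is ?eq)
proof -
  \<comment> \<open>\<open>\<sigma> n\<close> is the least multiple of \<open>1 / (n + 1)\<close>
    strictly above \<open>\<tau>\<close>: \<open>f n\<close> gives the index of the grid cell and
    \<open>g n\<close> its right end point.\<close>
  define f :: "nat \<Rightarrow> real \<Rightarrow> nat" where "f n x = nat \<lfloor>real (Suc n) * x\<rfloor>" for n x
  define g :: "nat \<Rightarrow> nat \<Rightarrow> real" where "g n m = real (Suc m) / real (Suc n)" for n m
  define \<sigma> where "\<sigma> n \<omega> = g n (f n (\<tau> \<omega>))" for n \<omega>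
  have [measurable]: "f n \<in> measurable borel (count_space UNIV)" for n
    unfolding f_def by measurable
  have g: "g n m > 0" for n m
    by (simp add: g_def)
  then have [measurable]: "N (g n m) \<in> measurable M (count_space UNIV)" for n m
    using pp by (auto simp: poisson_process_def less_imp_le)
  have [measurable]: "\<sigma> n \<in> borel_measurable M" for n
    unfolding \<sigma>_def by measurable
  have [measurable]: "(\<lambda>\<omega>. N (\<sigma> n \<omega>) \<omega>) \<in> measurable M (count_space UNIV)" for n
    unfolding \<sigma>_def by (rule measurable_compose_countable[where g="\<lambda>\<omega>. f n (\<tau> \<omega>)"]) measurable
  have less: "\<tau> \<omega> < \<sigma> n \<omega>" and le: "\<sigma> n \<omega> \<le> \<tau> \<omega> + 1 / real (Suc n)" if "\<omega> \<in> space M" for n \<omega>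
  proof -
    have "real (f n (\<tau> \<omega>)) = of_int \<lfloor>real (Suc n) * \<tau> \<omega>\<rfloor>"
      using nonneg that by (simp add: f_def)
    then have "real (Suc n) * \<tau> \<omega> < real (Suc (f n (\<tau> \<omega>)))"
        "real (Suc (f n (\<tau> \<omega>))) \<le> real (Suc n) * \<tau> \<omega> + 1"
      by (auto simp del: of_nat_Suc simp: of_nat_Suc[of "f n (\<tau> \<omega>)"]) linarith
    then show "\<tau> \<omega> < \<sigma> n \<omega>" "\<sigma> n \<omega> \<le> \<tau> \<omega> + 1 / real (Suc n)"
      by (simp_all add: \<sigma>_def g_def field_simps del: of_nat_Suc)
  qed
  have lim: "(\<lambda>n. \<sigma> n \<omega>) \<longlonglongrightarrow> \<tau> \<omega>" if "\<omega> \<in> space M" for \<omega>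
  proof (rule real_tendsto_sandwich[where f="\<lambda>_. \<tau> \<omega>"])
    show "(\<lambda>n. \<tau> \<omega> + 1 / real (Suc n)) \<longlonglongrightarrow> \<tau> \<omega>"
      by real_asymp
  qed (use less[OF that] le[OF that] in \<open>auto simp: less_imp_le\<close>)
  \<comment> \<open>Since \<open>nat\<close> is discrete, right-continuity means eventual equality.
    The strict inequality \<open>less\<close> makes \<open>\<sigma> n \<omega>\<close> converge
    along \<open>at_right (\<tau> \<omega>)\<close>.\<close>
  have ev: "eventually (\<lambda>n. N (\<sigma> n \<omega>) \<omega> = N (\<tau> \<omega>) \<omega>) sequentially" if "\<omega> \<in> space M" for \<omega>
  proof -
    have "continuous (at_right (\<tau> \<omega>)) (\<lambda>s. N s \<omega>)"
      using pp nonneg that by (auto simp: poisson_process_def)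
    then have "eventually (\<lambda>s. N s \<omega> = N (\<tau> \<omega>) \<omega>) (at_right (\<tau> \<omega>))"
      by (simp add: continuous_within tendsto_discrete)
    moreover have "filterlim (\<lambda>n. \<sigma> n \<omega>) (at_right (\<tau> \<omega>)) sequentially"
      using lim[OF that] less[OF that, THEN less_imp_neq] less[OF that] by (auto simp: filterlim_at eq_commute[of _ "\<tau> \<omega>"] intro!: always_eventually dest: less_imp_neq)
    ultimately show ?thesis
      by (rule eventually_compose_filterlim)
  qed
  \<comment> \<open>Measurability is obtained for a pointwise limit of real functions and carried
    back to \<open>nat\<close> by the floor.\<close>
  have "(\<lambda>\<omega>. real (N (\<tau> \<omega>) \<omega>)) \<in> borel_measurable M"
  proof (rule borel_measurable_LIMSEQ_real)
    show "(\<lambda>n. real (N (\<sigma> n \<omega>) \<omega>)) \<longlonglongrightarrow> real (N (\<tau> \<omega>) \<omega>)" if "\<omega> \<in> space M" for \<omega>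
      using ev[OF that] by (intro tendsto_eventually) (auto elim: eventually_mono)
  qed measurable
  then have "(\<lambda>\<omega>. nat \<lfloor>real (N (\<tau> \<omega>) \<omega>)\<rfloor>) \<in> measurable M (count_space UNIV)"
    by measurable
  then show meas[measurable]: ?meas
    by simp
  let ?p = "\<lambda>x. x ^ k / fact k * exp (- x)"
  \<comment> \<open>The identity is known for each \<open>\<sigma> n\<close>. Both of its sides pass
    to the limit by dominated convergence with majorant 1, since indicators and Poisson point masses
    are at most 1.\<close>
  have "(\<lambda>n. \<integral>\<^sup>+\<omega>. indicator {\<omega>\<in>space M. N (\<sigma> n \<omega>) \<omega> = k} \<omega> \<partial>M) \<longlonglongrightarrow>
      (\<integral>\<^sup>+\<omega>. indicator {\<omega>\<in>space M. N (\<tau> \<omega>) \<omega> = k} \<omega> \<partial>M)"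
  proof (rule nn_integral_dominated_convergence[where w="\<lambda>_. 1"])
    show "AE \<omega> in M. (\<lambda>n. indicator {\<omega>\<in>space M. N (\<sigma> n \<omega>) \<omega> = k} \<omega> :: ennreal)
        \<longlonglongrightarrow> indicator {\<omega>\<in>space M. N (\<tau> \<omega>) \<omega> = k} \<omega>"
    proof (rule AE_I2)
      fix \<omega> assume "\<omega> \<in> space M"
      from ev[OF this] show "(\<lambda>n. indicator {\<omega>\<in>space M. N (\<sigma> n \<omega>) \<omega> = k} \<omega> :: ennreal)
        \<longlonglongrightarrow> indicator {\<omega>\<in>space M. N (\<tau> \<omega>) \<omega> = k} \<omega>"
        by (intro tendsto_eventually) (auto elim!: eventually_mono simp: indicator_def)
    qed
  qed (auto split: split_indicator simp: emeasure_space_1)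
  moreover have "(\<lambda>n. \<integral>\<^sup>+\<omega>. ennreal (?p (rate * \<sigma> n \<omega>)) \<partial>M) \<longlonglongrightarrow> (\<integral>\<^sup>+\<omega>. ennreal (?p (rate * \<tau> \<omega>)) \<partial>M)"
  proof (rule nn_integral_dominated_convergence[where w="\<lambda>_. 1"])
    show "AE \<omega> in M. ennreal (?p (rate * \<sigma> n \<omega>)) \<le> 1" for n
    proof -
      have "?p (rate * \<sigma> n \<omega>) \<le> 1" for \<omega>
        using g[of n "f n (\<tau> \<omega>)"] \<open>rate > 0\<close> pmf_le_1[of "poisson_pmf (rate * \<sigma> n \<omega>)" k]
        by (simp add: \<sigma>_def)
      then show ?thesis by simp
    qed
    show "AE \<omega> in M. (\<lambda>n. ennreal (?p (rate * \<sigma> n \<omega>))) \<longlonglongrightarrow> ennreal (?p (rate * \<tau> \<omega>))"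
      by (intro AE_I2 tendsto_ennrealI tendsto_intros lim) auto
  qed (auto simp: emeasure_space_1)
  moreover have "(\<integral>\<^sup>+\<omega>. indicator {\<omega>\<in>space M. N (\<sigma> n \<omega>) \<omega> = k} \<omega> \<partial>M) =
      (\<integral>\<^sup>+\<omega>. ennreal (?p (rate * \<sigma> n \<omega>)) \<partial>M)" for n
    using poisson_process_discrete_time[OF pp ind \<open>rate > 0\<close> \<tau> _ g, where f="f n" and J="\<lambda>\<omega>. f n (\<tau> \<omega>)" and k=k]
    by (simp add: \<sigma>_def)
  ultimately have "(\<integral>\<^sup>+\<omega>. indicator {\<omega>\<in>space M. N (\<tau> \<omega>) \<omega> = k} \<omega> \<partial>M) = (\<integral>\<^sup>+\<omega>. ennreal (?p (rate * \<tau> \<omega>)) \<partial>M)"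
    by (auto intro: LIMSEQ_unique)
  then show ?eq
    by simp
qed

end

section \<open>Erlang densities and survival functions\<close>

text \<open>Index \<open>k\<close> stands for shape \<open>k + 1\<close>. Values in
  \<open>ennreal\<close> let Tonelli apply without integrability conditions.\<close>

definition erlang_transform :: "nat \<Rightarrow> real \<Rightarrow> (real \<Rightarrow> ennreal) \<Rightarrow> ennreal" where
  "erlang_transform k l G = (\<integral>\<^sup>+x. ennreal (erlang_density k l x) * G x \<partial>lborel)"

text \<open>The density of index \<open>Suc k\<close> is the convolution of those of index
  \<open>k\<close> and 0; Tonelli and the shift \<open>z = x + y\<close> then expose
  \<open>G (x + y)\<close>.\<close>

lemma erlang_transform_Suc:
  assumes "l > 0" and [measurable]: "G \<in> borel_measurable borel"
  shows "erlang_transform (Suc k) l G =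
    (\<integral>\<^sup>+y. \<integral>\<^sup>+x. ennreal (erlang_density k l x) * (ennreal (erlang_density 0 l y) * G (x + y))
      \<partial>lborel \<partial>lborel)"
proof -
  let ?e = "\<lambda>k x. ennreal (erlang_density k l x)"
  have "?e (Suc k) = (\<lambda>z. \<integral>\<^sup>+y. ?e k (z - y) * ?e 0 y \<partial>lborel)"
    using convolution_erlang_density[OF \<open>l > 0\<close>, of k 0] by simp
  then have "erlang_transform (Suc k) l G = (\<integral>\<^sup>+z. (\<integral>\<^sup>+y. ?e k (z - y) * ?e 0 y \<partial>lborel) * G z \<partial>lborel)"
    unfolding erlang_transform_def by metis
  also have "\<dots> = (\<integral>\<^sup>+z. \<integral>\<^sup>+y. ?e k (z - y) * ?e 0 y * G z \<partial>lborel \<partial>lborel)"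
    by (simp add: nn_integral_multc)
  also have "\<dots> = (\<integral>\<^sup>+y. \<integral>\<^sup>+z. ?e k (z - y) * ?e 0 y * G z \<partial>lborel \<partial>lborel)"
    by (rule lborel_pair.Fubini') (simp add: split_beta')
  also have "\<dots> = (\<integral>\<^sup>+y. \<integral>\<^sup>+x. ?e k x * (?e 0 y * G (x + y)) \<partial>lborel \<partial>lborel)"
  proof (rule nn_integral_cong)
    fix y :: real
    show "(\<integral>\<^sup>+z. ?e k (z - y) * ?e 0 y * G z \<partial>lborel) = (\<integral>\<^sup>+x. ?e k x * (?e 0 y * G (x + y)) \<partial>lborel)"
      by (subst nn_integral_real_affine[where c=1 and t=y]) (simp_all add: mult.assoc add.commute)
  qed
  finally show ?thesis .
qed

text \<open>Gives the product the shape of \<open>erlang_transform_Suc\<close>, with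
  \<open>G x * G y\<close> in place of \<open>G (x + y)\<close>, so that the two compare integrand
  by integrand.\<close>

lemma erlang_transform_mult:
  assumes [measurable]: "G \<in> borel_measurable borel"
  shows "erlang_transform k l G * erlang_transform 0 l G =
    (\<integral>\<^sup>+y. \<integral>\<^sup>+x. ennreal (erlang_density k l x) * (ennreal (erlang_density 0 l y) * (G x * G y))
      \<partial>lborel \<partial>lborel)"
proof -
  let ?e = "\<lambda>k x. ennreal (erlang_density k l x)"
  have "(\<integral>\<^sup>+y. \<integral>\<^sup>+x. ?e k x * (?e 0 y * (G x * G y)) \<partial>lborel \<partial>lborel) =
      (\<integral>\<^sup>+y. \<integral>\<^sup>+x. (?e k x * G x) * (?e 0 y * G y) \<partial>lborel \<partial>lborel)"
    by (simp add: ac_simps)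
  also have "\<dots> = (\<integral>\<^sup>+y. erlang_transform k l G * (?e 0 y * G y) \<partial>lborel)"
    unfolding erlang_transform_def by (intro nn_integral_cong nn_integral_multc) measurable
  also have "\<dots> = erlang_transform k l G * erlang_transform 0 l G"
    unfolding erlang_transform_def by (intro nn_integral_cmult) measurable
  finally show ?thesis ..
qed

lemma erlang_transform_Suc_le:
  assumes "l > 0" and [measurable]: "G \<in> borel_measurable borel"
    and G: "\<And>x y. x \<ge> 0 \<Longrightarrow> y \<ge> 0 \<Longrightarrow> G (x + y) \<le> G x * G y"
  shows "erlang_transform (Suc k) l G \<le> erlang_transform k l G * erlang_transform 0 l G"
  unfolding erlang_transform_Suc[OF assms(1,2)] erlang_transform_mult[OF assms(2)]
proof (intro nn_integral_mono)
  fix x y :: real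
  show "ennreal (erlang_density k l x) * (ennreal (erlang_density 0 l y) * G (x + y))
      \<le> ennreal (erlang_density k l x) * (ennreal (erlang_density 0 l y) * (G x * G y))"
    \<comment> \<open>If \<open>x\<close> or \<open>y\<close> is negative, one density vanishes and
      both sides are 0.\<close>
    by (cases "x < 0 \<or> y < 0") (auto simp: erlang_density_def intro!: mult_left_mono G)
qed

lemma erlang_transform_Suc_ge:
  assumes "l > 0" and [measurable]: "G \<in> borel_measurable borel"
    and G: "\<And>x y. x \<ge> 0 \<Longrightarrow> y \<ge> 0 \<Longrightarrow> G x * G y \<le> G (x + y)"
  shows "erlang_transform k l G * erlang_transform 0 l G \<le> erlang_transform (Suc k) l G"
  unfolding erlang_transform_Suc[OF assms(1,2)] erlang_transform_mult[OF assms(2)]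
proof (intro nn_integral_mono)
  fix x y :: real
  show "ennreal (erlang_density k l x) * (ennreal (erlang_density 0 l y) * (G x * G y))
      \<le> ennreal (erlang_density k l x) * (ennreal (erlang_density 0 l y) * G (x + y))"
    by (cases "x < 0 \<or> y < 0") (auto simp: erlang_density_def intro!: mult_left_mono G)
qed

text \<open>This is the exponential series of \<open>l * x\<close> multiplied by
  \<open>l * exp (- l * x)\<close>.\<close>

lemma erlang_density_sums:
  assumes "x \<ge> 0"
  shows "(\<lambda>k. erlang_density k l x) sums l"
proof -
  have "(\<lambda>k. (l * exp (- l * x)) * ((l * x) ^ k /\<^sub>R fact k)) sums ((l * exp (- l * x)) * exp (l * x))"
    by (intro sums_mult exp_converges)
  moreover have "(l * exp (- l * x)) * exp (l * x) = l"
    by (simp add: exp_minus)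
  moreover have "(l * exp (- l * x)) * ((l * x) ^ k /\<^sub>R fact k) = erlang_density k l x" for k
    using assms by (simp add: erlang_density_def power_mult_distrib field_simps)
  ultimately show ?thesis
    by (simp only:)
qed

text \<open>Tonelli reduces this to \<open>erlang_density_sums\<close>. The indicator records that
  the densities vanish on the negative half-line, where \<open>G\<close> need not.\<close>

lemma suminf_erlang_transform:
  assumes "l > 0" and [measurable]: "G \<in> borel_measurable borel"
  shows "(\<Sum>k. erlang_transform k l G) = ennreal l * (\<integral>\<^sup>+x. indicator {0..} x * G x \<partial>lborel)"
proof -
  have "(\<Sum>k. ennreal (erlang_density k l x) * G x) = ennreal l * (indicator {0..} x * G x)" for x
  proof (cases "x < 0")
    case False
    then have "(\<Sum>k. ennreal (erlang_density k l x)) = ennreal l"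
      using erlang_density_sums[of x l] \<open>l > 0\<close>
      by (subst suminf_ennreal2) (auto simp: sums_iff)
    with False show ?thesis
      by simp
  qed (simp add: erlang_density_def)
  then have "(\<Sum>k. erlang_transform k l G) = (\<integral>\<^sup>+x. ennreal l * (indicator {0..} x * G x) \<partial>lborel)"
    unfolding erlang_transform_def by (subst nn_integral_suminf[symmetric]) auto
  then show ?thesis
    by (simp add: nn_integral_cmult)
qed

section \<open>Survival functions and the tails of the stopped process\<close>

context prob_space
begin

definition survival :: "('a \<Rightarrow> real) \<Rightarrow> real \<Rightarrow> ennreal" where
  "survival \<tau> x = emeasure M {\<omega>\<in>space M. x < \<tau> \<omega>}"

text \<open>An integrand jointly measurable in \<open>x\<close> and \<open>\<omega>\<close> gives
  access both to measurability in \<open>x\<close> and to Fubini.\<close>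

lemma survival_eq_nn_integral:
  assumes [measurable]: "\<tau> \<in> borel_measurable M"
  shows "survival \<tau> x = (\<integral>\<^sup>+\<omega>. indicator {..<\<tau> \<omega>} x \<partial>M)"
proof -
  have "(\<integral>\<^sup>+\<omega>. indicator {..<\<tau> \<omega>} x \<partial>M) = (\<integral>\<^sup>+\<omega>. indicator {\<omega>\<in>space M. x < \<tau> \<omega>} \<omega> \<partial>M)"
    by (intro nn_integral_cong) (auto simp: indicator_def)
  then show ?thesis
    by (simp add: survival_def)
qed

lemma borel_measurable_indicator_less:
  assumes [measurable]: "f \<in> borel_measurable N" "g \<in> borel_measurable N"
  shows "(\<lambda>x. indicator {..<f x :: real} (g x) :: ennreal) \<in> borel_measurable N"
  unfolding indicator_def lessThan_iff by measurable

lemma borel_measurable_survival[measurable]: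
  assumes [measurable]: "\<tau> \<in> borel_measurable M"
  shows "survival \<tau> \<in> borel_measurable borel"
proof -
  have "(\<lambda>x. \<integral>\<^sup>+\<omega>. indicator {..<\<tau> \<omega>} x \<partial>M) \<in> borel_measurable borel"
    unfolding indicator_def lessThan_iff by measurable
  then show ?thesis
    by (simp add: survival_eq_nn_integral cong: measurable_cong)
qed

text \<open>The layer-cake formula, by Fubini. An Erlang density as \<open>h\<close> yields the mean
  of the Erlang distribution function at \<open>\<tau>\<close>; the indicator of the half-line
  yields the mean of \<open>\<tau>\<close>.\<close>

lemma nn_integral_mult_survival:
  assumes [measurable]: "\<tau> \<in> borel_measurable M" "h \<in> borel_measurable borel"
  shows "(\<integral>\<^sup>+x. h x * survival \<tau> x \<partial>lborel) = (\<integral>\<^sup>+\<omega>. \<integral>\<^sup>+x. h x * indicator {..<\<tau> \<omega>} x \<partial>lborel \<partial>M)"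
proof -
  interpret pair_sigma_finite lborel M ..
  have "(\<integral>\<^sup>+x. h x * survival \<tau> x \<partial>lborel) = (\<integral>\<^sup>+x. \<integral>\<^sup>+\<omega>. h x * indicator {..<\<tau> \<omega>} x \<partial>M \<partial>lborel)"
    unfolding survival_eq_nn_integral[OF assms(1)]
    by (intro nn_integral_cong nn_integral_cmult[symmetric]) (simp add: borel_measurable_indicator_less)
  also have "\<dots> = (\<integral>\<^sup>+\<omega>. \<integral>\<^sup>+x. h x * indicator {..<\<tau> \<omega>} x \<partial>lborel \<partial>M)"
    by (intro Fubini'[symmetric]) (auto simp: split_beta' intro!: borel_measurable_times_ennreal borel_measurable_indicator_less)
  finally show ?thesis .
qed

lemma nn_integral_erlang_CDF_compose:
  assumes "l > 0" and [measurable]: "\<tau> \<in> borel_measurable M"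
  shows "(\<integral>\<^sup>+\<omega>. ennreal (erlang_CDF k l (\<tau> \<omega>)) \<partial>M) = erlang_transform k l (survival \<tau>)"
proof -
  have "ennreal (erlang_CDF k l a) = (\<integral>\<^sup>+x. ennreal (erlang_density k l x) * indicator {..<a} x \<partial>lborel)" for a
  proof -
    \<comment> \<open>The distribution function integrates up to and including \<open>a\<close>, the
      strict tail only below \<open>a\<close>; the difference is a null set.\<close>
    have "(\<integral>\<^sup>+x. ennreal (erlang_density k l x) * indicator {..a} x \<partial>lborel) =
        (\<integral>\<^sup>+x. ennreal (erlang_density k l x) * indicator {..<a} x \<partial>lborel)"
      using AE_lborel_singleton[of a] by (intro nn_integral_cong_AE) (auto split: split_indicator)
    then show ?thesis
      by (simp add: nn_integral_erlang_density \<open>l > 0\<close>)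
  qed
  then show ?thesis
    by (simp add: erlang_transform_def nn_integral_mult_survival)
qed

lemma nn_integral_survival:
  assumes [measurable]: "\<tau> \<in> borel_measurable M" and "\<forall>\<omega>\<in>space M. \<tau> \<omega> \<ge> 0"
  shows "(\<integral>\<^sup>+x. indicator {0..} x * survival \<tau> x \<partial>lborel) = (\<integral>\<^sup>+\<omega>. ennreal (\<tau> \<omega>) \<partial>M)"
proof (subst nn_integral_mult_survival)
  show "(\<integral>\<^sup>+\<omega>. \<integral>\<^sup>+x. indicator {0..} x * indicator {..<\<tau> \<omega>} x \<partial>lborel \<partial>M) = (\<integral>\<^sup>+\<omega>. ennreal (\<tau> \<omega>) \<partial>M)"
  proof (intro nn_integral_cong)
    fix \<omega> assume "\<omega> \<in> space M"
    have "(\<integral>\<^sup>+x. indicator {0..} x * indicator {..<\<tau> \<omega>} x \<partial>lborel) = (\<integral>\<^sup>+x. indicator {0..<\<tau> \<omega>} x \<partial>lborel)"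
      by (intro nn_integral_cong) (auto split: split_indicator)
    then show "(\<integral>\<^sup>+x. indicator {0..} x * indicator {..<\<tau> \<omega>} x \<partial>lborel) = ennreal (\<tau> \<omega>)"
      using assms(2) \<open>\<omega> \<in> space M\<close> by simp
  qed
qed measurable

text \<open>No arrival times are constructed. At each value of \<open>\<tau>\<close> the Poisson
  masses up to \<open>k\<close> and \<open>erlang_CDF k\<close> add up to 1; after integration the
  finite probability of \<open>N (\<tau> \<omega>) \<omega> \<le> k\<close> cancels.\<close>

lemma poisson_process_random_time_tail:
  assumes pp: "poisson_process rate N" and ind: "indep_of_process \<tau> N" and "rate > 0"
    and \<tau>[measurable]: "\<tau> \<in> borel_measurable M" and nonneg: "\<forall>\<omega>\<in>space M. \<tau> \<omega> \<ge> 0"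
  shows "emeasure M {\<omega>\<in>space M. k < N (\<tau> \<omega>) \<omega>} = erlang_transform k rate (survival \<tau>)"
proof -
  note eq = poisson_process_random_time[OF assms]
  have [measurable]: "(\<lambda>\<omega>. N (\<tau> \<omega>) \<omega>) \<in> measurable M (count_space UNIV)"
    by (rule eq)
  let ?p = "\<lambda>n \<omega>. (rate * \<tau> \<omega>) ^ n / fact n * exp (- (rate * \<tau> \<omega>))"
  have [measurable]: "(\<lambda>\<omega>. erlang_CDF k rate (\<tau> \<omega>)) \<in> borel_measurable M"
    unfolding erlang_CDF_def by measurable
  let ?L = "emeasure M {\<omega>\<in>space M. N (\<tau> \<omega>) \<omega> \<le> k}"
  have "?L = emeasure M (\<Union>n\<in>{..k}. {\<omega>\<in>space M. N (\<tau> \<omega>) \<omega> = n})"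
    by (rule arg_cong[where f="emeasure M"]) auto
  also have "\<dots> = (\<Sum>n\<le>k. emeasure M {\<omega>\<in>space M. N (\<tau> \<omega>) \<omega> = n})"
    by (intro sum_emeasure[symmetric]) (auto simp: disjoint_family_on_def)
  also have "\<dots> = (\<integral>\<^sup>+\<omega>. (\<Sum>n\<le>k. ennreal (?p n \<omega>)) \<partial>M)"
    by (subst nn_integral_sum) (auto simp: eq)
  finally have L: "?L = (\<integral>\<^sup>+\<omega>. (\<Sum>n\<le>k. ennreal (?p n \<omega>)) \<partial>M)" .
  have "?L + emeasure M {\<omega>\<in>space M. k < N (\<tau> \<omega>) \<omega>} =
      emeasure M ({\<omega>\<in>space M. N (\<tau> \<omega>) \<omega> \<le> k} \<union> {\<omega>\<in>space M. k < N (\<tau> \<omega>) \<omega>})"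
    by (intro plus_emeasure) auto
  also have "{\<omega>\<in>space M. N (\<tau> \<omega>) \<omega> \<le> k} \<union> {\<omega>\<in>space M. k < N (\<tau> \<omega>) \<omega>} = space M"
    by auto
  also have "emeasure M (space M) = (\<integral>\<^sup>+\<omega>. 1 \<partial>M)"
    by simp
  also have "\<dots> = (\<integral>\<^sup>+\<omega>. (\<Sum>n\<le>k. ennreal (?p n \<omega>)) + ennreal (erlang_CDF k rate (\<tau> \<omega>)) \<partial>M)"
  proof (intro nn_integral_cong)
    fix \<omega> assume "\<omega> \<in> space M"
    then have "\<tau> \<omega> \<ge> 0"
      using nonneg by auto
    then have "(\<Sum>n\<le>k. ennreal (?p n \<omega>)) = ennreal (\<Sum>n\<le>k. ?p n \<omega>)"
      using \<open>rate > 0\<close> by (intro sum_ennreal) auto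
    moreover have "(\<Sum>n\<le>k. ?p n \<omega>) + erlang_CDF k rate (\<tau> \<omega>) = 1"
      using \<open>\<tau> \<omega> \<ge> 0\<close> by (simp add: erlang_CDF_def)
    moreover have "(\<Sum>n\<le>k. ?p n \<omega>) \<ge> 0"
      using \<open>\<tau> \<omega> \<ge> 0\<close> \<open>rate > 0\<close> by (intro sum_nonneg) auto
    ultimately show "1 = (\<Sum>n\<le>k. ennreal (?p n \<omega>)) + ennreal (erlang_CDF k rate (\<tau> \<omega>))"
      using \<open>rate > 0\<close> by (simp flip: ennreal_plus)
  qed
  also have "\<dots> = ?L + erlang_transform k rate (survival \<tau>)"
    by (subst nn_integral_add) (simp_all add: L nn_integral_erlang_CDF_compose \<open>rate > 0\<close>)
  finally show ?thesis
    by (simp add: ennreal_add_left_cancel)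
qed

end

section \<open>Total variation distance to a geometric law\<close>

lemma measure_nat_sums:
  fixes \<mu> :: "nat measure"
  assumes "finite_measure \<mu>" and [simp]: "sets \<mu> = UNIV"
  shows "(\<lambda>k. measure \<mu> {k} * indicator A k) sums measure \<mu> A"
proof -
  interpret finite_measure \<mu> by fact
  have "(\<lambda>k. measure \<mu> ({k} \<inter> A)) sums measure \<mu> (\<Union>k. {k} \<inter> A)"
    by (intro finite_measure_UNION) (auto simp: disjoint_family_on_def)
  moreover have "measure \<mu> ({k} \<inter> A) = measure \<mu> {k} * indicator A k" for k
    by (cases "k \<in> A") auto
  ultimately show ?thesis by simp
qed

lemma tv_dist_commute: "tv_dist \<mu> \<nu> = tv_dist \<nu> \<mu>"
  by (simp add: tv_dist_def abs_minus_commute)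

text \<open>A one-sided bound suffices: for probability measures, passing from \<open>A\<close> to
  its complement flips the sign of the difference, so a bound over all sets also bounds the absolute
  value.\<close>

lemma tv_dist_le_sums:
  fixes \<mu> \<nu> :: "nat measure"
  assumes "prob_space \<mu>" "prob_space \<nu>" and sets: "sets \<mu> = UNIV" "sets \<nu> = UNIV"
    and d: "d sums c" "\<And>k. d k \<ge> 0" "\<And>k. measure \<mu> {k} - measure \<nu> {k} \<le> d k"
  shows "tv_dist \<mu> \<nu> \<le> c"
proof -
  interpret \<mu>: prob_space \<mu> by fact
  interpret \<nu>: prob_space \<nu> by fact
  have le: "measure \<mu> A - measure \<nu> A \<le> c" for A
  proof (rule sums_le[OF _ _ \<open>d sums c\<close>])
    show "(\<lambda>k. measure \<mu> {k} * indicator A k - measure \<nu> {k} * indicator A k) sums (measure \<mu> A - measure \<nu> A)"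
      by (intro sums_diff measure_nat_sums sets) unfold_locales
    show "measure \<mu> {k} * indicator A k - measure \<nu> {k} * indicator A k \<le> d k" for k
      \<comment> \<open>Outside \<open>A\<close> the left side is 0, which is where
        \<open>d k \<ge> 0\<close> enters.\<close>
      using d(2,3)[of k] by (auto split: split_indicator)
  qed
  have "space \<mu> = UNIV" "space \<nu> = UNIV"
    using sets sets.sets_into_space[of UNIV \<mu>] sets.sets_into_space[of UNIV \<nu>] by auto
  then have "measure \<nu> A - measure \<mu> A = measure \<mu> (- A) - measure \<nu> (- A)" for A
    using \<mu>.prob_compl[of A] \<nu>.prob_compl[of A] sets by (simp add: Compl_eq_Diff_UNIV)
  with le show ?thesis
    unfolding tv_dist_def by (intro cSUP_least) (auto simp: abs_le_iff minus_diff_eq)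
qed

lemma (in prob_space) prob_singleton_eq_tail_diff:
  fixes W :: "'a \<Rightarrow> nat"
  assumes [measurable]: "W \<in> measurable M (count_space UNIV)"
  shows "prob {\<omega>\<in>space M. W \<omega> = k} = prob {\<omega>\<in>space M. k \<le> W \<omega>} - prob {\<omega>\<in>space M. Suc k \<le> W \<omega>}"
proof -
  have "{\<omega>\<in>space M. W \<omega> = k} = {\<omega>\<in>space M. k \<le> W \<omega>} - {\<omega>\<in>space M. Suc k \<le> W \<omega>}"
    by auto
  then show ?thesis
    by (simp add: finite_measure_Diff subset_eq)
qed

text \<open>Here \<open>m\<close> is the mean of \<open>W\<close>, written as the sum of its tails.
  The defects \<open>(1 - p) * S k - S (Suc k)\<close> have one sign and add up to
  \<open>(1 - p) * (1 + m) - m\<close>, which gives both bounds.\<close>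

lemma (in prob_space)
  fixes W :: "'a \<Rightarrow> nat"
  assumes W[measurable]: "W \<in> measurable M (count_space UNIV)"
    and p: "0 < p" "p \<le> 1"
    and m: "(\<lambda>k. prob {\<omega>\<in>space M. Suc k \<le> W \<omega>}) sums m"
  shows tv_dist_geometric_le:
      "(\<And>k. prob {\<omega>\<in>space M. Suc k \<le> W \<omega>} \<le> (1 - p) * prob {\<omega>\<in>space M. k \<le> W \<omega>}) \<Longrightarrow>
        tv_dist (distr M (count_space UNIV) W) (measure_pmf (geometric_pmf p)) \<le> 1 - p * (1 + m)"
    and tv_dist_geometric_ge:
      "(\<And>k. (1 - p) * prob {\<omega>\<in>space M. k \<le> W \<omega>} \<le> prob {\<omega>\<in>space M. Suc k \<le> W \<omega>}) \<Longrightarrow>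
        tv_dist (distr M (count_space UNIV) W) (measure_pmf (geometric_pmf p)) \<le> p * (1 + m) - 1"
proof -
  let ?\<mu> = "distr M (count_space UNIV) W" and ?\<nu> = "measure_pmf (geometric_pmf p)"
  define S where "S k = prob {\<omega>\<in>space M. k \<le> W \<omega>}" for k
  have S0: "S 0 = 1"
    by (simp add: S_def prob_space)
  have \<mu>: "measure ?\<mu> {k} = S k - S (Suc k)" for k
  proof -
    have "measure ?\<mu> {k} = prob {\<omega>\<in>space M. W \<omega> = k}"
      by (simp add: measure_distr vimage_def Int_def conj_commute)
    then show ?thesis
      by (simp add: prob_singleton_eq_tail_diff S_def)
  qed
  have \<nu>: "measure ?\<nu> {k} = (1 - p) ^ k * p" for k
    using p by (simp add: measure_pmf_single)
  have "(\<lambda>k. S (Suc k)) sums m"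
    using m by (simp add: S_def)
  moreover from this have "S sums (m + S 0)"
    by (simp add: sums_Suc_iff)
  ultimately have "(\<lambda>k. (1 - p) * S k - S (Suc k)) sums ((1 - p) * (m + S 0) - m)"
    by (intro sums_diff sums_mult)
  then have D: "(\<lambda>k. (1 - p) * S k - S (Suc k)) sums (1 - p * (1 + m))"
    by (simp add: S0 algebra_simps)
  have prob: "prob_space ?\<mu>" "prob_space ?\<nu>" "sets ?\<mu> = UNIV" "sets ?\<nu> = UNIV"
    by (auto intro: prob_space_distr measure_pmf.prob_space_axioms)
  {
    assume "\<And>k. prob {\<omega>\<in>space M. Suc k \<le> W \<omega>} \<le> (1 - p) * prob {\<omega>\<in>space M. k \<le> W \<omega>}"
    then have step: "S (Suc k) \<le> (1 - p) * S k" for k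
      by (simp add: S_def)
    have "S k \<le> (1 - p) ^ k" for k
    proof (induction k)
      case (Suc k)
      then have "(1 - p) * S k \<le> (1 - p) ^ Suc k"
        using p by (simp add: mult_left_mono)
      with step[of k] show ?case by simp
    qed (simp add: S0)
    then have "S k * p \<le> (1 - p) ^ k * p" for k
      using p by (simp add: mult_right_mono)
    \<comment> \<open>The mass of \<open>W\<close> at \<open>k\<close> is the defect plus
      \<open>p * S k\<close>, and the geometric mass is \<open>p * (1 - p) ^ k\<close>, so the tail
      comparison decides.\<close>
    then have "measure ?\<mu> {k} - measure ?\<nu> {k} \<le> (1 - p) * S k - S (Suc k)" for k
      unfolding \<mu> \<nu> by (simp add: algebra_simps)
    then show "tv_dist ?\<mu> ?\<nu> \<le> 1 - p * (1 + m)"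
      using step by (intro tv_dist_le_sums[OF prob D]) auto
  }
  {
    assume "\<And>k. (1 - p) * prob {\<omega>\<in>space M. k \<le> W \<omega>} \<le> prob {\<omega>\<in>space M. Suc k \<le> W \<omega>}"
    then have step: "(1 - p) * S k \<le> S (Suc k)" for k
      by (simp add: S_def)
    have "(1 - p) ^ k \<le> S k" for k
    proof (induction k)
      case (Suc k)
      then have "(1 - p) ^ Suc k \<le> (1 - p) * S k"
        using p by (simp add: mult_left_mono)
      with step[of k] show ?case by simp
    qed (simp add: S0)
    then have "(1 - p) ^ k * p \<le> S k * p" for k
      using p by (simp add: mult_right_mono)
    \<comment> \<open>The geometric tails are now the smaller ones, so the masses are subtracted in
      the opposite order and the defects change sign; \<open>tv_dist\<close> is symmetric.\<close>
    then have "measure ?\<nu> {k} - measure ?\<mu> {k} \<le> - ((1 - p) * S k - S (Suc k))" for k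
      unfolding \<mu> \<nu> by (simp add: algebra_simps)
    then show "tv_dist ?\<mu> ?\<nu> \<le> p * (1 + m) - 1"
      using step sums_minus[OF D] unfolding tv_dist_commute[of ?\<mu>]
      by (intro tv_dist_le_sums[OF prob(2,1,4,3)]) auto
  }
qed

section \<open>Tails at NBU and NWU times\<close>

context prob_space
begin

text \<open>The mass formula at \<open>k = 0\<close> identifies \<open>p\<close>; the range
  \<open>0 < p \<le> 1\<close> makes \<open>geometric_pmf p\<close> the intended law.\<close>

lemma poisson_process_random_time_zero:
  assumes "poisson_process rate N" "indep_of_process \<tau> N" "rate > 0"
    and \<tau>[measurable]: "\<tau> \<in> borel_measurable M" and nonneg: "\<forall>\<omega>\<in>space M. \<tau> \<omega> \<ge> 0"
  defines "p \<equiv> (\<integral>\<omega>. exp (- rate * \<tau> \<omega>) \<partial>M)"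
  shows "prob {\<omega>\<in>space M. N (\<tau> \<omega>) \<omega> = 0} = p" "0 < p" "p \<le> 1"
proof -
  have "integrable M (\<lambda>\<omega>. exp (- rate * \<tau> \<omega>))"
    using nonneg \<open>rate > 0\<close> by (intro integrable_const_bound[where B=1]) (auto intro!: AE_I2)
  then have "(\<integral>\<^sup>+\<omega>. ennreal (exp (- rate * \<tau> \<omega>)) \<partial>M) = ennreal p"
    unfolding p_def by (intro nn_integral_eq_integral) auto
  then have eq: "ennreal (prob {\<omega>\<in>space M. N (\<tau> \<omega>) \<omega> = 0}) = ennreal p"
    using poisson_process_random_time(2)[OF assms(1-5), of 0] by (simp add: emeasure_eq_measure)
  have "p \<ge> 0"
    unfolding p_def by (intro Bochner_Integration.integral_nonneg) auto
  with eq show p: "prob {\<omega>\<in>space M. N (\<tau> \<omega>) \<omega> = 0} = p"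
    by simp
  then show "p \<le> 1"
    using prob_le_1 by metis
  \<comment> \<open>A vanishing integral would force the strictly positive exponential to be 0
    almost everywhere.\<close>
  have "p \<noteq> 0"
  proof
    assume "p = 0"
    then have "AE \<omega> in M. ennreal (exp (- rate * \<tau> \<omega>)) = 0"
      using \<open>(\<integral>\<^sup>+\<omega>. ennreal (exp (- rate * \<tau> \<omega>)) \<partial>M) = ennreal p\<close>
      by (subst nn_integral_0_iff_AE[symmetric]) auto
    then show False
      by simp
  qed
  with \<open>p \<ge> 0\<close> show "0 < p"
    by simp
qed

text \<open>Stated in \<open>ennreal\<close> because the mean may be infinite in the NWU case.
  Summing the Erlang densities leaves \<open>rate\<close> times the integral of the survival
  function.\<close>

lemma poisson_process_random_time_tail_sums:
  assumes "poisson_process rate N" "indep_of_process \<tau> N" "rate > 0"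
    and \<tau>[measurable]: "\<tau> \<in> borel_measurable M" and nonneg: "\<forall>\<omega>\<in>space M. \<tau> \<omega> \<ge> 0"
  shows "(\<lambda>k. ennreal (prob {\<omega>\<in>space M. Suc k \<le> N (\<tau> \<omega>) \<omega>})) sums
    (ennreal rate * (\<integral>\<^sup>+\<omega>. ennreal (\<tau> \<omega>) \<partial>M))"
proof -
  have "ennreal (prob {\<omega>\<in>space M. Suc k \<le> N (\<tau> \<omega>) \<omega>}) = erlang_transform k rate (survival \<tau>)" for k
    using poisson_process_random_time_tail[OF assms, of k] by (simp add: emeasure_eq_measure Suc_le_eq)
  then have "(\<Sum>k. ennreal (prob {\<omega>\<in>space M. Suc k \<le> N (\<tau> \<omega>) \<omega>})) =
      ennreal rate * (\<integral>\<^sup>+\<omega>. ennreal (\<tau> \<omega>) \<partial>M)"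
    using assms by (simp add: suminf_erlang_transform nn_integral_survival)
  then show ?thesis
    by (simp add: sums_iff)
qed

lemma poisson_process_random_time_tail_Suc:
  assumes "poisson_process rate N" "indep_of_process \<tau> N" "rate > 0"
    and \<tau>[measurable]: "\<tau> \<in> borel_measurable M" and nonneg: "\<forall>\<omega>\<in>space M. \<tau> \<omega> \<ge> 0"
  defines "p \<equiv> (\<integral>\<omega>. exp (- rate * \<tau> \<omega>) \<partial>M)"
  defines "S \<equiv> \<lambda>k. prob {\<omega>\<in>space M. k \<le> N (\<tau> \<omega>) \<omega>}"
  shows "NBU \<tau> \<Longrightarrow> S (Suc k) \<le> (1 - p) * S k" and "NWU \<tau> \<Longrightarrow> (1 - p) * S k \<le> S (Suc k)"
proof -
  have W[measurable]: "(\<lambda>\<omega>. N (\<tau> \<omega>) \<omega>) \<in> measurable M (count_space UNIV)"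
    by (rule poisson_process_random_time[OF assms(1-5)])
  have S0: "S 0 = 1"
    by (simp add: S_def prob_space)
  have S1: "S (Suc 0) = 1 - p"
    using prob_singleton_eq_tail_diff[OF W, of 0] poisson_process_random_time_zero(1)[OF assms(1-5)]
    by (simp add: S_def p_def prob_space)
  have S: "ennreal (S (Suc k)) = erlang_transform k rate (survival \<tau>)" for k
    using poisson_process_random_time_tail[OF assms(1-5), of k]
    by (simp add: emeasure_eq_measure Suc_le_eq S_def)
  have S_nonneg: "S k \<ge> 0" for k
    by (simp add: S_def)
  \<comment> \<open>The factor of index 0 is the probability \<open>S 1 = 1 - p\<close> of at least
    one arrival.\<close>
  have prod: "erlang_transform k rate (survival \<tau>) * erlang_transform 0 rate (survival \<tau>) =
      ennreal ((1 - p) * S (Suc k))" for k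
    using S_nonneg[of "Suc 0"] S_nonneg[of "Suc k"]
    by (simp add: S[symmetric] S1 ennreal_mult mult.commute)
  \<comment> \<open>Index \<open>j\<close> of the transform corresponds to \<open>S (Suc j)\<close>,
    so \<open>k = 0\<close> stands apart; there both sides equal \<open>1 - p\<close>.\<close>
  show "S (Suc k) \<le> (1 - p) * S k" if "NBU \<tau>"
  proof (cases k)
    case (Suc j)
    have "erlang_transform (Suc j) rate (survival \<tau>) \<le>
        erlang_transform j rate (survival \<tau>) * erlang_transform 0 rate (survival \<tau>)"
      using that \<open>rate > 0\<close>
      by (intro erlang_transform_Suc_le)
        (auto simp: NBU_def survival_def emeasure_eq_measure simp flip: ennreal_mult)
    then have "ennreal (S (Suc (Suc j))) \<le> ennreal ((1 - p) * S (Suc j))"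
      by (simp only: prod S)
    \<comment> \<open>\<open>ennreal\<close> truncates negative reals to 0, so returning to the
      reals needs a non-negative right side.\<close>
    moreover have "(1 - p) * S (Suc j) \<ge> 0"
      using S_nonneg[of "Suc 0"] S_nonneg[of "Suc j"] by (simp add: S1)
    ultimately show ?thesis
      by (simp add: Suc)
  qed (simp add: S0 S1)
  show "(1 - p) * S k \<le> S (Suc k)" if "NWU \<tau>"
  proof (cases k)
    case (Suc j)
    have "erlang_transform j rate (survival \<tau>) * erlang_transform 0 rate (survival \<tau>) \<le>
        erlang_transform (Suc j) rate (survival \<tau>)"
      using that \<open>rate > 0\<close>
      by (intro erlang_transform_Suc_ge)
        (auto simp: NWU_def survival_def emeasure_eq_measure simp flip: ennreal_mult)
    then have "ennreal ((1 - p) * S (Suc j)) \<le> ennreal (S (Suc (Suc j)))"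
      by (simp only: prod S)
    then show ?thesis
      using S_nonneg[of "Suc (Suc j)"] by (simp add: Suc)
  qed (simp add: S0 S1)
qed

end

section \<open>Total variation bounds at NBU and NWU times\<close>

theorem theorem2p3:
  fixes M :: "'a measure" and N :: "real \<Rightarrow> 'a \<Rightarrow> nat" and \<tau> :: "'a \<Rightarrow> real" and rate :: real
  defines "p \<equiv> (\<integral>\<omega>. exp (- rate * \<tau> \<omega>) \<partial>M)"
  assumes "prob_space M"
    and "rate > 0"
    and "prob_space.poisson_process M rate N"
    and "\<tau> \<in> borel_measurable M"
    and "\<forall>\<omega>\<in>space M. \<tau> \<omega> \<ge> 0"
    and "prob_space.indep_of_process M \<tau> N"
  shows "(prob_space.NBU M \<tau> \<longrightarrow>
            ereal (tv_dist (distr M (count_space UNIV) (\<lambda>\<omega>. N (\<tau> \<omega>) \<omega>))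
                           (measure_pmf (geometric_pmf p)))
              \<le> 1 - ereal p * (1 + ereal rate * ext_mean M \<tau>)) \<and>
         (prob_space.NWU M \<tau> \<longrightarrow>
            ereal (tv_dist (distr M (count_space UNIV) (\<lambda>\<omega>. N (\<tau> \<omega>) \<omega>))
                           (measure_pmf (geometric_pmf p)))
              \<le> ereal p * (1 + ereal rate * ext_mean M \<tau>) - 1)"
proof -
  interpret prob_space M by fact
  note asms = assms(4,7,3,5,6)
  define S where "S k = prob {\<omega>\<in>space M. k \<le> N (\<tau> \<omega>) \<omega>}" for k
  let ?E = "\<integral>\<^sup>+\<omega>. ennreal (\<tau> \<omega>) \<partial>M"
  have W: "(\<lambda>\<omega>. N (\<tau> \<omega>) \<omega>) \<in> measurable M (count_space UNIV)"
    by (rule poisson_process_random_time[OF asms])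
  have p: "0 < p" "p \<le> 1"
    using poisson_process_random_time_zero[OF asms] by (simp_all add: p_def)
  have S_nonneg: "S k \<ge> 0" for k
    by (simp add: S_def)
  have ennreal_sums: "(\<lambda>k. ennreal (S (Suc k))) sums (ennreal rate * ?E)"
    using poisson_process_random_time_tail_sums[OF asms] by (simp add: S_def)
  have real_sums: "(\<lambda>k. S (Suc k)) sums (rate * e)" if "?E = ennreal e" "e \<ge> 0" for e
    using ennreal_sums that S_nonneg \<open>rate > 0\<close> by (simp flip: ennreal_mult)
  show ?thesis
  proof (intro conjI impI)
    assume "NBU \<tau>"
    then have step: "S (Suc k) \<le> (1 - p) * S k" for k
      using poisson_process_random_time_tail_Suc(1)[OF asms] by (simp add: S_def p_def)
    \<comment> \<open>The tails shrink by a factor of at most \<open>1 - p < 1\<close>, so they are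
      summable. As \<open>rate > 0\<close>, this forces a finite mean and lets the extended bound be
      read in the reals.\<close>
    have "summable S"
      using p step S_nonneg by (intro summable_ratio_test[where c="1 - p"]) auto
    then have "summable (\<lambda>k. S (Suc k))"
      by (subst summable_Suc_iff)
    then have "ennreal rate * ?E = ennreal (\<Sum>k. S (Suc k))"
      using ennreal_sums S_nonneg by (simp add: sums_iff suminf_ennreal2)
    then have "?E \<noteq> \<top>"
      using \<open>rate > 0\<close> by (auto simp: ennreal_mult_top)
    then obtain e where e: "?E = ennreal e" "e \<ge> 0"
      by (cases ?E) auto
    have "tv_dist (distr M (count_space UNIV) (\<lambda>\<omega>. N (\<tau> \<omega>) \<omega>)) (measure_pmf (geometric_pmf p))
        \<le> 1 - p * (1 + rate * e)"
      using real_sums[OF e] step unfolding S_def by (intro tv_dist_geometric_le W p)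
    then show "ereal (tv_dist (distr M (count_space UNIV) (\<lambda>\<omega>. N (\<tau> \<omega>) \<omega>)) (measure_pmf (geometric_pmf p)))
        \<le> 1 - ereal p * (1 + ereal rate * ext_mean M \<tau>)"
      using e by (simp add: ext_mean_def one_ereal_def)
  next
    assume "NWU \<tau>"
    then have step: "(1 - p) * S k \<le> S (Suc k)" for k
      using poisson_process_random_time_tail_Suc(2)[OF asms] by (simp add: S_def p_def)
    show "ereal (tv_dist (distr M (count_space UNIV) (\<lambda>\<omega>. N (\<tau> \<omega>) \<omega>)) (measure_pmf (geometric_pmf p)))
        \<le> ereal p * (1 + ereal rate * ext_mean M \<tau>) - 1"
    \<comment> \<open>With infinite mean the right side is infinite, since \<open>p\<close> and
      \<open>rate\<close> are positive, and the bound is trivial.\<close>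
    proof (cases "?E = \<top>")
      case True
      then show ?thesis
        using p \<open>rate > 0\<close> by (simp add: ext_mean_def)
    next
      case False
      then obtain e where e: "?E = ennreal e" "e \<ge> 0"
        by (cases ?E) auto
      have "tv_dist (distr M (count_space UNIV) (\<lambda>\<omega>. N (\<tau> \<omega>) \<omega>)) (measure_pmf (geometric_pmf p))
          \<le> p * (1 + rate * e) - 1"
        using real_sums[OF e] step unfolding S_def by (intro tv_dist_geometric_ge W p)
      then show ?thesis
        using e by (simp add: ext_mean_def one_ereal_def)
    qed
  qed
qed

end
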